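(* Let $\ell\ge 1$ and define recursively $(a_0,b_0)=(\ell+1,2\ell+2)$ and, for all $n\ge 1$, \[ a_n=\mathrm{mex}(\{a_i,b_i: i<n\}\cup\{0,1,\dots,\ell\}),\qquad b_n=a_n+n+\ell+1 . \] Then the set of non-terminal $\mathcal{P}$-positions of $K^\ell$ is $\{(a_n,b_n): n\ge 0\}\cup\{(b_n,a_n): n\ge 0\}$.
   Context: $\mathrm{mex}\,S=\min(\mathbb{N}\setminus S)$. Positions are pairs $(x,y)\in\mathbb{N}^2$. A Wythoff move from $(x,y)$ leads to $(x-i,y)$ with $1\le i\le x$, to $(x,y-i)$ with $1\le i\le y$, or to $(x-i,y-i)$ with $1\le i\le\min(x,y)$. For $\ell\in\mathbb{N}$, $K^\ell$ is the two-player impartial game with Wythoff moves in which the positions of $\{(x,y): x+y\le\ell\}$ are terminal: no move is allowed from a terminal position, and a player who moves into a terminal position wins (normal play). A $\mathcal{P}$-position is a position from which the previous player has a winning strategy. *)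

theory Defs
  imports Main
begin

definition mex :: "nat set \<Rightarrow> nat" where
  "mex S = (LEAST n. n \<notin> S)"


text \<open>
  An impartial game is given by its option function \<open>opt\<close>.  A play from \<open>p\<close> is the list of
  positions visited so far, starting with \<open>p\<close> itself.  The next player moves from the positions
  with even index, the previous player from those with odd index.
\<close>

definition is_play :: "('p \<Rightarrow> 'p set) \<Rightarrow> 'p \<Rightarrow> 'p list \<Rightarrow> bool" where
  "is_play opt p ps \<longleftrightarrow>
     ps \<noteq> [] \<and> hd ps = p \<and> (\<forall>i. Suc i < length ps \<longrightarrow> ps ! Suc i \<in> opt (ps ! i))"

definition is_complete_play :: "('p \<Rightarrow> 'p set) \<Rightarrow> 'p \<Rightarrow> 'p list \<Rightarrow> bool" where
  "is_complete_play opt p ps \<longleftrightarrow> is_play opt p ps \<and> opt (last ps) = {}"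

text \<open>
  A strategy may depend on the whole history of the play.  In a play of even length it is the
  previous player's turn.
\<close>

definition previous_strategy :: "('p \<Rightarrow> 'p set) \<Rightarrow> 'p \<Rightarrow> ('p list \<Rightarrow> 'p) \<Rightarrow> bool" where
  "previous_strategy opt p \<sigma> \<longleftrightarrow>
     (\<forall>ps. is_play opt p ps \<and> even (length ps) \<and> opt (last ps) \<noteq> {} \<longrightarrow> \<sigma> ps \<in> opt (last ps))"

definition previous_follows :: "('p list \<Rightarrow> 'p) \<Rightarrow> 'p list \<Rightarrow> bool" where
  "previous_follows \<sigma> ps \<longleftrightarrow>
     (\<forall>i. odd i \<and> Suc i < length ps \<longrightarrow> ps ! Suc i = \<sigma> (take (Suc i) ps))"

text \<open>
  Normal play: whoever moves into a position without options wins.  A complete play of odd length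
  ends with a move of the previous player; this includes the one-element play, where the previous
  player has just moved into \<open>p\<close>.  Only finite plays are considered, so the definition is meant
  for games without infinite plays.
\<close>

definition P_position :: "('p \<Rightarrow> 'p set) \<Rightarrow> 'p \<Rightarrow> bool" where
  "P_position opt p \<longleftrightarrow>
     (\<exists>\<sigma>. previous_strategy opt p \<sigma> \<and>
       (\<forall>ps. is_complete_play opt p ps \<and> previous_follows \<sigma> ps \<longrightarrow> odd (length ps)))"


definition wythoff_moves :: "nat \<times> nat \<Rightarrow> (nat \<times> nat) set" where
  "wythoff_moves = (\<lambda>(x, y).
     {(x - i, y) | i. 1 \<le> i \<and> i \<le> x} \<union>
     {(x, y - i) | i. 1 \<le> i \<and> i \<le> y} \<union>
     {(x - i, y - i) | i. 1 \<le> i \<and> i \<le> min x y})"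

definition K_terminal :: "nat \<Rightarrow> (nat \<times> nat) set" where
  "K_terminal l = {(x, y). x + y \<le> l}"

definition K_moves :: "nat \<Rightarrow> nat \<times> nat \<Rightarrow> (nat \<times> nat) set" where
  "K_moves l p = (if p \<in> K_terminal l then {} else wythoff_moves p)"

lemma K_moves_empty_iff: "K_moves l p = {} \<longleftrightarrow> p \<in> K_terminal l"
proof (cases p)
  case (Pair x y)
  show ?thesis
  proof (cases "x + y \<le> l")
    case True
    then show ?thesis by (simp add: Pair K_moves_def K_terminal_def)
  next
    case False
    then have "x \<ge> 1 \<or> y \<ge> 1" by auto
    then have "(x - 1, y) \<in> wythoff_moves p \<or> (x, y - 1) \<in> wythoff_moves p"
      unfolding Pair wythoff_moves_def by fastforce
    then show ?thesis using False by (auto simp: Pair K_moves_def K_terminal_def)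
  qed
qed

text \<open>Every play of \<open>K\<^sup>l\<close> is finite.\<close>

lemma K_moves_decrease:
  assumes "(x', y') \<in> K_moves l (x, y)"
  shows "x' + y' < x + y"
  using assms by (auto simp: K_moves_def wythoff_moves_def split: if_splits)


function seq_a :: "nat \<Rightarrow> nat \<Rightarrow> nat" and seq_b :: "nat \<Rightarrow> nat \<Rightarrow> nat" where
  "seq_a l n =
     (if n = 0 then l + 1 else mex ((\<Union>i\<in>{..<n}. {seq_a l i, seq_b l i}) \<union> {0..l}))"
| "seq_b l n = (if n = 0 then 2 * l + 2 else seq_a l n + n + l + 1)"
  by pat_completeness auto
termination
  by (relation "measure (\<lambda>s. case s of Inl (l, n) \<Rightarrow> 2 * n | Inr (l, n) \<Rightarrow> 2 * n + 1)") auto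

declare seq_a.simps [simp del] seq_b.simps [simp del]

end

theory Submission
  imports Defs
begin

text \<open>
  The P-positions of a game without infinite plays are the unique kernel of its option relation: a
  set \<open>W\<close> such that a position lies in \<open>W\<close> iff none of its options does.  For \<open>K\<^sup>l\<close> the kernel
  consists of the terminal positions together with the pairs \<open>(a\<^sub>n, b\<^sub>n)\<close> and their mirror images.
  A non-terminal position has a terminal option iff one coordinate, or the difference of the
  coordinates, is at most \<open>l\<close>.  On the remaining positions Wythoff's argument applies, since
  \<open>a\<close> and \<open>b\<close> enumerate complementary subsets of the numbers greater than \<open>l\<close> and the differences
  \<open>b\<^sub>n - a\<^sub>n = n + l + 1\<close> are exactly the numbers greater than \<open>l\<close>.
\<close>

section \<open>Kernels and P-positions\<close>

lemma is_play_append1: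
  assumes "is_play opt p ps" "q \<in> opt (last ps)"
  shows "is_play opt p (ps @ [q])"
proof -
  have "(ps @ [q]) ! Suc i \<in> opt ((ps @ [q]) ! i)" if "Suc i < length (ps @ [q])" for i
  proof (cases "Suc i = length ps")
    case True
    then have "i = length ps - 1" "ps \<noteq> []" by auto
    then show ?thesis using assms True by (simp add: nth_append last_conv_nth)
  next
    case False
    then show ?thesis using assms that by (simp add: nth_append is_play_def)
  qed
  then show ?thesis using assms by (auto simp: is_play_def)
qed

lemma previous_follows_append1:
  assumes "previous_follows \<sigma> ps" "even (length ps) \<Longrightarrow> q = \<sigma> ps"
  shows "previous_follows \<sigma> (ps @ [q])"
  unfolding previous_follows_def
proof (intro allI impI, elim conjE)
  fix i assume i: "odd i" "Suc i < length (ps @ [q])"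
  show "(ps @ [q]) ! Suc i = \<sigma> (take (Suc i) (ps @ [q]))"
  proof (cases "Suc i = length ps")
    case True
    then have "even (length ps)" using i(1) by (metis even_Suc)
    then show ?thesis using True assms(2) by (simp add: nth_append)
  next
    case False
    then show ?thesis using assms(1) i by (simp add: nth_append previous_follows_def)
  qed
qed

text \<open>The previous player always answers into \<open>W\<close>. Then exactly the positions of
  even index lie in \<open>W\<close>. A final position has no options, so it lies in
  \<open>W\<close>; its index is even and the length of the play is odd.\<close>

lemma kernel_imp_P_position:
  assumes kernel: "\<And>p. p \<in> W \<longleftrightarrow> opt p \<inter> W = {}" and "p \<in> W"
  shows "P_position opt p"
proof -
  \<comment> \<open>The first branch only keeps \<open>\<sigma>\<close> legal after plays that have
    left the invariant.\<close>
  define \<sigma> where "\<sigma> ps =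
    (if opt (last ps) \<inter> W = {} then SOME r. r \<in> opt (last ps) else SOME r. r \<in> opt (last ps) \<inter> W)"
    for ps
  have \<sigma>_W: "\<sigma> ps \<in> opt (last ps) \<inter> W" if "opt (last ps) \<inter> W \<noteq> {}" for ps
    using that some_in_eq[of "opt (last ps) \<inter> W"] by (simp add: \<sigma>_def)
  have \<sigma>_opt: "\<sigma> ps \<in> opt (last ps)" if "opt (last ps) \<noteq> {}" for ps
    using that \<sigma>_W[of ps] some_in_eq[of "opt (last ps)"]
    by (cases "opt (last ps) \<inter> W = {}") (simp_all add: \<sigma>_def)
  have "previous_strategy opt p \<sigma>"
    using \<sigma>_opt by (simp add: previous_strategy_def)
  moreover have "odd (length ps)"
    if cp: "is_complete_play opt p ps" and fol: "previous_follows \<sigma> ps" for ps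
  proof -
    have ne: "ps \<noteq> []" and hd: "ps ! 0 = p" and final: "opt (last ps) = {}"
      and step: "\<And>i. Suc i < length ps \<Longrightarrow> ps ! Suc i \<in> opt (ps ! i)"
      using cp by (auto simp: is_complete_play_def is_play_def hd_conv_nth)
    have alternate: "ps ! i \<in> W \<longleftrightarrow> even i" if "i < length ps" for i
      using that
    proof (induction i)
      case 0
      then show ?case using \<open>p \<in> W\<close> hd by simp
    next
      case (Suc i)
      show ?case
      proof (cases "even i")
        case True
        then have "ps ! i \<in> W" using Suc by simp
        then have "ps ! Suc i \<notin> W" using kernel[of "ps ! i"] step[of i] Suc.prems by blast
        then show ?thesis using True by simp
      next
        case False
        let ?qs = "take (Suc i) ps"
        have "last ?qs = ps ! i" using Suc.prems by (simp add: take_Suc_conv_app_nth)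
        moreover have "ps ! i \<notin> W" using Suc False by simp
        ultimately have "\<sigma> ?qs \<in> W" using \<sigma>_W[of ?qs] kernel[of "ps ! i"] by auto
        moreover have "ps ! Suc i = \<sigma> ?qs"
          using fol False Suc.prems by (simp add: previous_follows_def)
        ultimately show ?thesis using False by simp
      qed
    qed
    have "last ps \<in> W" using kernel[of "last ps"] final by simp
    then have "even (length ps - 1)"
      using alternate[of "length ps - 1"] ne by (simp add: last_conv_nth)
    then show ?thesis using ne by (cases ps) auto
  qed
  ultimately show ?thesis unfolding P_position_def by blast
qed

text \<open>Outside \<open>W\<close> the next player can move into \<open>W\<close>, and every reply
  leaves \<open>W\<close> again. Against any \<open>\<sigma>\<close> this produces a play that can
  only stop just after a move of the next player.\<close>

lemma P_position_imp_kernel: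
  assumes wf: "wf {(q, p). q \<in> opt p}"
    and kernel: "\<And>p. p \<in> W \<longleftrightarrow> opt p \<inter> W = {}"
    and "P_position opt p"
  shows "p \<in> W"
proof (rule ccontr)
  assume "p \<notin> W"
  obtain \<sigma> where \<sigma>: "previous_strategy opt p \<sigma>"
    and odd: "\<And>ps. is_complete_play opt p ps \<Longrightarrow> previous_follows \<sigma> ps \<Longrightarrow> odd (length ps)"
    using \<open>P_position opt p\<close> unfolding P_position_def by blast
  have False
    if "is_play opt p ps" "previous_follows \<sigma> ps" "odd (length ps)" "last ps = q" "q \<notin> W" for q ps
    \<comment> \<open>A round consists of two moves, so the induction runs over the transitive
      closure.\<close>
    using wf_trancl[OF wf] that
  proof (induction q arbitrary: ps rule: wf_induct_rule)
    case (less q)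
    obtain r where r: "r \<in> opt q" "r \<in> W" using kernel[of q] less.prems by blast
    let ?qs = "ps @ [r]"
    have qs: "is_play opt p ?qs" "previous_follows \<sigma> ?qs" "even (length ?qs)"
      using less.prems r by (auto intro: is_play_append1 previous_follows_append1)
    show False
    proof (cases "opt r = {}")
      case True
      then show False using odd[of ?qs] qs by (simp add: is_complete_play_def)
    next
      case False
      let ?s = "\<sigma> ?qs"
      have s: "?s \<in> opt r" using \<sigma> qs False unfolding previous_strategy_def by (metis last_snoc)
      then have "?s \<notin> W" using kernel[of r] r by blast
      moreover have "(?s, q) \<in> {(q, p). q \<in> opt p}\<^sup>+" using s r(1) by (auto intro: trancl.intros)
      moreover have "is_play opt p (?qs @ [?s])" "previous_follows \<sigma> (?qs @ [?s])"
        using is_play_append1[OF qs(1), of ?s] previous_follows_append1[OF qs(2), of ?s] s by simp_all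
      ultimately show False using less.IH[of ?s "?qs @ [?s]"] less.prems(3) by simp
    qed
  qed
  moreover have "is_play opt p [p]" "previous_follows \<sigma> [p]"
    by (auto simp: is_play_def previous_follows_def)
  ultimately show False using \<open>p \<notin> W\<close> by fastforce
qed

section \<open>The sequences\<close>

lemma mex_notin: "finite S \<Longrightarrow> mex S \<notin> S"
  unfolding mex_def by (rule LeastI_ex) (use ex_new_if_finite infinite_UNIV_nat in blast)

lemma less_mex_imp_in: "m < mex S \<Longrightarrow> m \<in> S"
  unfolding mex_def using not_less_Least by blast

definition used :: "nat \<Rightarrow> nat \<Rightarrow> nat set" where
  "used l n = (\<Union>i\<in>{..<n}. {seq_a l i, seq_b l i}) \<union> {0..l}"

lemma used_mono: "m \<le> n \<Longrightarrow> used l m \<subseteq> used l n"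
  by (fastforce simp: used_def)

text \<open>The prescribed start is no exception: for \<open>n = 0\<close> only
  \<open>{0..l}\<close> is excluded.\<close>

lemma seq_a_eq_mex: "seq_a l n = mex (used l n)"
proof (cases "n = 0")
  case True
  have "mex {0..l} = l + 1" unfolding mex_def by (rule Least_equality) auto
  then show ?thesis using True by (simp add: seq_a.simps used_def)
next
  case False
  then show ?thesis by (subst seq_a.simps) (simp add: used_def)
qed

lemma seq_b_eq: "seq_b l n = seq_a l n + n + l + 1"
  by (cases "n = 0") (simp_all add: seq_b.simps seq_a.simps[of l 0])

lemma seq_a_notin_used: "seq_a l n \<notin> used l n"
  unfolding seq_a_eq_mex by (rule mex_notin) (simp add: used_def)

lemma seq_a_gt: "l < seq_a l n"
  using seq_a_notin_used[of l n] by (simp add: used_def)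

lemma strict_mono_seq_a: "strict_mono (seq_a l)"
proof (rule strict_monoI)
  fix m n :: nat assume "m < n"
  then have "seq_a l m \<noteq> seq_a l n" using seq_a_notin_used[of l n] unfolding used_def
    by (metis UN_I UnI1 insertI1 lessThan_iff)
  moreover have "\<not> seq_a l n < seq_a l m"
    \<comment> \<open>A value below \<open>seq_a l m\<close> is already in \<open>used l m\<close>,
      hence in \<open>used l n\<close>, which \<open>seq_a l n\<close> avoids.\<close>
    using less_mex_imp_in[of "seq_a l n" "used l m"] seq_a_eq_mex[of l m] seq_a_notin_used[of l n]
      used_mono[of m n l] \<open>m < n\<close> by auto
  ultimately show "seq_a l m < seq_a l n" by simp
qed

lemma seq_b_less: "m < n \<Longrightarrow> seq_b l m < seq_b l n"
  using strict_monoD[OF strict_mono_seq_a, of m n l] by (simp add: seq_b_eq)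

text \<open>For \<open>m < n\<close> the mex avoids \<open>seq_b l m\<close>; otherwise
  \<open>seq_b l m\<close> exceeds \<open>seq_a l m\<close>, which is at least
  \<open>seq_a l n\<close>.\<close>

lemma seq_a_neq_seq_b: "seq_a l n \<noteq> seq_b l m"
proof (cases "m < n")
  case True
  then show ?thesis using seq_a_notin_used[of l n] by (auto simp: used_def)
next
  case False
  then have "seq_a l n \<le> seq_a l m" by (simp add: strict_mono_less_eq[OF strict_mono_seq_a])
  then show ?thesis by (simp add: seq_b_eq)
qed

lemma seq_a_or_seq_b:
  assumes "l < x"
  obtains n where "x = seq_a l n" | n where "x = seq_b l n"
proof -
  \<comment> \<open>A number below a mex belongs to the excluded set, so an index whose mex exceeds
    \<open>x\<close> suffices.\<close>
  have "x < seq_a l (Suc x)"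
    using strict_mono_imp_increasing[OF strict_mono_seq_a, of "Suc x" l] by simp
  then have "x \<in> used l (Suc x)" using less_mex_imp_in seq_a_eq_mex by metis
  then show thesis using that assms by (auto simp: used_def)
qed

section \<open>The kernel of the game\<close>

text \<open>This form avoids truncated subtraction, which makes moves accessible to linear
  arithmetic.\<close>

lemma K_moves_iff:
  "(x', y') \<in> K_moves l (x, y) \<longleftrightarrow>
     l < x + y \<and> (x' < x \<and> y' = y \<or> x' = x \<and> y' < y \<or> (\<exists>d>0. x = x' + d \<and> y = y' + d))"
proof -
  have "(\<exists>i. x' = x - i \<and> y' = y - i \<and> 1 \<le> i \<and> i \<le> min x y) \<longleftrightarrow>
        (\<exists>d>0. x = x' + d \<and> y = y' + d)"
    by (intro iff_exI) auto
  moreover have "(\<exists>i. z' = z - i \<and> 1 \<le> i \<and> i \<le> z) \<longleftrightarrow> z' < z" for z z' :: nat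
    by (auto intro!: exI[of _ "z - z'"])
  ultimately show ?thesis
    unfolding K_moves_def K_terminal_def wythoff_moves_def by (auto simp: not_le)
qed

lemma K_moves_swap: "(y', x') \<in> K_moves l (y, x) \<longleftrightarrow> (x', y') \<in> K_moves l (x, y)"
  unfolding K_moves_iff by (auto simp: add.commute)

lemma wf_K_moves: "wf {(q, p). q \<in> K_moves l p}"
  by (rule wf_subset[OF wf_measure[of "\<lambda>(x, y). x + y"]]) (auto dest: K_moves_decrease)

definition wythoff_pairs :: "nat \<Rightarrow> (nat \<times> nat) set" where
  "wythoff_pairs l = {(seq_a l n, seq_b l n) | n. n \<ge> 0} \<union> {(seq_b l n, seq_a l n) | n. n \<ge> 0}"

definition K_kernel :: "nat \<Rightarrow> (nat \<times> nat) set" where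
  "K_kernel l = K_terminal l \<union> wythoff_pairs l"

lemma K_kernel_swap: "(y, x) \<in> K_kernel l \<longleftrightarrow> (x, y) \<in> K_kernel l"
  by (auto simp: K_kernel_def K_terminal_def wythoff_pairs_def)

lemma wythoff_pairs_disjoint_K_terminal: "wythoff_pairs l \<inter> K_terminal l = {}"
proof -
  have "\<not> seq_a l n + seq_b l n \<le> l" "\<not> seq_b l n + seq_a l n \<le> l" for n
    using seq_a_gt[of l n] by simp_all
  then show ?thesis by (auto simp: wythoff_pairs_def K_terminal_def)
qed

lemma no_move_from_seq_to_kernel:
  assumes move: "(x, y) \<in> K_moves l (seq_a l n, seq_b l n)"
  shows "(x, y) \<notin> K_kernel l"
proof
  assume "(x, y) \<in> K_kernel l"
  then consider "x + y \<le> l" | m where "x = seq_a l m" "y = seq_b l m"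
    | m where "x = seq_b l m" "y = seq_a l m"
    by (auto simp: K_kernel_def K_terminal_def wythoff_pairs_def)
  then show False
  proof cases
    \<comment> \<open>Either a coordinate greater than \<open>l\<close> survives, or a diagonal move
      preserves the difference \<open>n + l + 1\<close>.\<close>
    case 1
    then show ?thesis using move seq_a_gt[of l n] by (auto simp: K_moves_iff seq_b_eq)
  next
    \<comment> \<open>Pairs with different indices differ in both coordinates and in their
      difference.\<close>
    case 2
    then have "m = n"
      using move strict_mono_eq[OF strict_mono_seq_a, of l m n] seq_b_less[of m n l]
        seq_b_less[of n m l]
      by (cases m n rule: linorder_cases) (auto simp: K_moves_iff seq_b_eq)
    then show ?thesis using move 2 by (auto simp: K_moves_iff)
  next
    \<comment> \<open>A row or column move would equate a value of \<open>seq_a\<close> with one of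
      \<open>seq_b\<close>; a diagonal move cannot reverse the order of the coordinates.\<close>
    case 3
    then show ?thesis
      using move seq_a_neq_seq_b[of l n m] seq_a_neq_seq_b[of l m n]
      by (auto simp: K_moves_iff) (auto simp: seq_b_eq)
  qed
qed

lemma move_to_kernel:
  assumes "x \<le> y" "(x, y) \<notin> K_kernel l"
  shows "\<exists>q. q \<in> K_moves l (x, y) \<and> q \<in> K_kernel l"
proof -
  have nt: "l < x + y" using assms by (auto simp: K_kernel_def K_terminal_def)
  have terminal: "(u, v) \<in> K_kernel l" if "u + v \<le> l" for u v
    using that by (simp add: K_kernel_def K_terminal_def)
  have pair: "(seq_a l n, seq_b l n) \<in> K_kernel l" "(seq_b l n, seq_a l n) \<in> K_kernel l" for n
    by (auto simp: K_kernel_def wythoff_pairs_def)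
  \<comment> \<open>In the first two cases a terminal position is reachable, by emptying the larger
    coordinate or diagonally by emptying the smaller one.\<close>
  consider "x \<le> l" | "l < x" "y \<le> x + l" | "l < x" "x + l < y" by linarith
  then show ?thesis
  proof cases
    case 1
    then have "(x, 0) \<in> K_moves l (x, y)" using nt assms(1) by (simp add: K_moves_iff)
    then show ?thesis using 1 terminal[of x 0] by auto
  next
    case 2
    then have "(0, y - x) \<in> K_moves l (x, y)" using nt assms(1) by (simp add: K_moves_iff)
    then show ?thesis using 2 terminal[of 0 "y - x"] by (metis add_0 le_diff_conv add.commute)
  next
    case 3
    from \<open>l < x\<close> show ?thesis
    proof (cases rule: seq_a_or_seq_b)
      case (1 n)
      have "y \<noteq> seq_b l n" using assms(2) 1 pair by auto
      then consider "seq_b l n < y" | "y < seq_b l n" by linarith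
      then show ?thesis
      proof cases
        case 1
        then have "(seq_a l n, seq_b l n) \<in> K_moves l (x, y)"
          using nt \<open>x = seq_a l n\<close> by (simp add: K_moves_iff)
        then show ?thesis using pair by blast
      next
        case 2
        \<comment> \<open>The index \<open>m\<close> is chosen so that the m-th pair has difference
          \<open>y - x\<close>; it lies on the diagonal through \<open>(x, y)\<close>.\<close>
        define m where "m = y - x - l - 1"
        have y: "y = x + m + l + 1" using 3 by (simp add: m_def)
        then have "m < n" using 1 2 by (simp add: seq_b_eq)
        then have "seq_a l m < x" using 1 strict_monoD[OF strict_mono_seq_a] by simp
        then have "\<exists>d>0. x = seq_a l m + d \<and> y = seq_b l m + d"
          using y by (intro exI[of _ "x - seq_a l m"]) (simp add: seq_b_eq)
        then have "(seq_a l m, seq_b l m) \<in> K_moves l (x, y)" using nt by (simp add: K_moves_iff)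
        then show ?thesis using pair by blast
      qed
    next
      \<comment> \<open>Here \<open>y\<close> is at least \<open>seq_b l n\<close>, so it can be
        lowered to \<open>seq_a l n\<close>.\<close>
      case (2 n)
      then have "(seq_b l n, seq_a l n) \<in> K_moves l (x, y)"
        using nt assms(1) by (simp add: K_moves_iff seq_b_eq)
      then show ?thesis using pair by blast
    qed
  qed
qed

lemma K_kernel_is_kernel: "p \<in> K_kernel l \<longleftrightarrow> K_moves l p \<inter> K_kernel l = {}"
proof
  assume "p \<in> K_kernel l"
  then consider "p \<in> K_terminal l" | n where "p = (seq_a l n, seq_b l n)"
    | n where "p = (seq_b l n, seq_a l n)"
    by (auto simp: K_kernel_def wythoff_pairs_def)
  then show "K_moves l p \<inter> K_kernel l = {}"
  proof cases
    case 1
    then show ?thesis by (simp add: K_moves_def)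
  next
    case 2
    then show ?thesis using no_move_from_seq_to_kernel by auto
  next
    case (3 n)
    then show ?thesis using no_move_from_seq_to_kernel[of _ _ l n] K_moves_swap K_kernel_swap
      by (metis disjoint_iff surj_pair)
  qed
next
  obtain x y where p: "p = (x, y)" by fastforce
  assume "K_moves l p \<inter> K_kernel l = {}"
  then show "p \<in> K_kernel l"
    using move_to_kernel[of x y l] move_to_kernel[of y x l] K_moves_swap K_kernel_swap nat_le_linear
    unfolding p by (metis disjoint_iff surj_pair)
qed

theorem theorem17:
  fixes l :: nat
  assumes "l \<ge> 1"
  shows "{p. p \<notin> K_terminal l \<and> P_position (K_moves l) p} =
         {(seq_a l n, seq_b l n) | n. n \<ge> 0} \<union> {(seq_b l n, seq_a l n) | n. n \<ge> 0}"
proof -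
  have "P_position (K_moves l) p \<longleftrightarrow> p \<in> K_kernel l" for p
    using kernel_imp_P_position[of "K_kernel l" "K_moves l", OF K_kernel_is_kernel]
      P_position_imp_kernel[OF wf_K_moves, of "K_kernel l" l, OF K_kernel_is_kernel] by blast
  then have "{p. p \<notin> K_terminal l \<and> P_position (K_moves l) p} = wythoff_pairs l"
    using wythoff_pairs_disjoint_K_terminal by (auto simp: K_kernel_def)
  then show ?thesis by (simp add: wythoff_pairs_def)
qed

end
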